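(* Let $\mathbb{A}$ be a PCA with elementary sub-PCA $\mathbb{A}'$. The Muchnik doctrine $\mathfrak{M}_w\colon\mathsf{Set}^{\mathrm{op}}\to\mathsf{Pos}$ is isomorphic to the full universal completion $(\mathbb{A}_w)^{\forall_{\mathsf f}}$ of the Muchnik doctrine of singletons $\mathbb{A}_w\colon\mathsf{Set}^{\mathrm{op}}\to\mathsf{Pos}$.
   Context: A partial combinatory algebra (PCA) is a set $\mathbb{A}$ with a partial binary operation $\cdot$ (application, associating to the left; $ab\downarrow$ means that $ab$ is defined; $x\simeq y$ means that $x$ is defined whenever $y$ is, in which case they are equal) for which there exist $k,s\in\mathbb{A}$ such that for all $a,b,c\in\mathbb{A}$: $ka\downarrow$, $kab\simeq a$, $sa\downarrow$, $sab\downarrow$, $sabc\simeq ac(bc)$. An elementary sub-PCA is a subset $\mathbb{A}'\subseteq\mathbb{A}$ closed under (defined) application that contains elements $k,s$ such that $ka\downarrow$, $kab\simeq a$, $sa\downarrow$, $sab\downarrow$ and $sabc\simeq ac(bc)$ for all $a,b,c\in\mathbb{A}$. A doctrine is a functor $P\colon\mathcal{C}^{\mathrm{op}}\to\mathsf{Pos}$ with $\mathcal{C}$ having finite products. An isomorphism of doctrines on the same base is a natural family of poset isomorphisms. Full universal completion ($\mathcal{C}$ with pullbacks): $P^{\forall_{\mathsf f}}(A)$ is the poset reflection of the preorder of pairs $(f,\alpha)$ with $f\colon B\to A$ in $\mathcal{C}$ and $\alpha\in P(B)$, where $(f\colon B\to A,\alpha)\le(g\colon C\to A,\beta)$ iff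 there is $h\colon C\to B$ with $f h=g$ and $P_h(\alpha)\le\beta$. For $u\colon A'\to A$, the action sends $(g\colon C\to A,\beta)$ to $(u^*g\colon D\to A',P_{g^*u}(\beta))$, where $D=A'\times_A C$ with projections $u^*g\colon D\to A'$ and $g^*u\colon D\to C$. Muchnik doctrine of singletons: $\mathbb{A}_w(X)$ is (the poset reflection of) the set of functions $X\to\mathbb{A}$ preordered by $\alpha\le_{\mathsf{dw}}\beta$ iff for every $x\in X$ there is $\overline a\in\mathbb{A}'$ such that $\overline a\cdot\beta(x)$ is defined and equals $\alpha(x)$; it acts on functions by precomposition. Muchnik doctrine: $\mathfrak{M}_w(X)$ is the poset reflection of the set of functions $X\to\wp(\mathbb{A})$ preordered by $\varphi\le_w\psi$ iff for all $x\in X$ and all $b\in\psi(x)$ there is $\overline a\in\mathbb{A}'$ with $\overline a\cdot b$ defined and $\overline a\cdot b\in\varphi(x)$; it acts on functions by precomposition. *)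

theory Defs
  imports "HOL-Algebra.Order" "HOL-Library.FuncSet"
begin

section \<open>Partial combinatory algebras\<close>

text \<open>The partial application is \<open>app a b\<close>, with \<open>None\<close> for undefined. \<open>lapp\<close> extends it strictly
  to possibly undefined arguments, so that compound applicative terms can be written.\<close>

definition lapp :: "('a \<Rightarrow> 'a \<Rightarrow> 'a option) \<Rightarrow> 'a option \<Rightarrow> 'a option \<Rightarrow> 'a option" where
  "lapp app x y = Option.bind x (\<lambda>a. Option.bind y (\<lambda>b. app a b))"

text \<open>Directed Kleene equality: \<open>x\<close> is defined whenever \<open>y\<close> is, and then they are equal.\<close>

definition kleene :: "'a option \<Rightarrow> 'a option \<Rightarrow> bool" where
  "kleene x y \<longleftrightarrow> (y \<noteq> None \<longrightarrow> x = y)"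

definition ks_laws :: "'a set \<Rightarrow> ('a \<Rightarrow> 'a \<Rightarrow> 'a option) \<Rightarrow> 'a \<Rightarrow> 'a \<Rightarrow> bool" where
  "ks_laws A app k s \<longleftrightarrow>
     (\<forall>a\<in>A. \<forall>b\<in>A. \<forall>c\<in>A.
        app k a \<noteq> None \<and>
        kleene (lapp app (app k a) (Some b)) (Some a) \<and>
        app s a \<noteq> None \<and>
        lapp app (app s a) (Some b) \<noteq> None \<and>
        kleene (lapp app (lapp app (app s a) (Some b)) (Some c))
               (lapp app (app a c) (app b c)))"

definition pca :: "'a set \<Rightarrow> ('a \<Rightarrow> 'a \<Rightarrow> 'a option) \<Rightarrow> bool" where
  "pca A app \<longleftrightarrow>
     (\<forall>a\<in>A. \<forall>b\<in>A. \<forall>c. app a b = Some c \<longrightarrow> c \<in> A) \<and>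
     (\<exists>k\<in>A. \<exists>s\<in>A. ks_laws A app k s)"

text \<open>The combinators lie in \<open>A'\<close>, but their laws are required for all elements of \<open>A\<close>.\<close>

definition elementary_sub_pca :: "'a set \<Rightarrow> ('a \<Rightarrow> 'a \<Rightarrow> 'a option) \<Rightarrow> 'a set \<Rightarrow> bool" where
  "elementary_sub_pca A app A' \<longleftrightarrow>
     A' \<subseteq> A \<and>
     (\<forall>a\<in>A'. \<forall>b\<in>A'. \<forall>c. app a b = Some c \<longrightarrow> c \<in> A') \<and>
     (\<exists>k\<in>A'. \<exists>s\<in>A'. ks_laws A app k s)"


section \<open>Categories with finite products, pullbacks\<close>

record ('o, 'm) cat =
  obj :: "'o set"
  arr :: "'m set"
  src :: "'m \<Rightarrow> 'o"
  tgt :: "'m \<Rightarrow> 'o"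
  ident :: "'o \<Rightarrow> 'm"
  cmp :: "'m \<Rightarrow> 'm \<Rightarrow> 'm"  \<comment> \<open>\<open>cmp C g f\<close> is \<open>g\<close> after \<open>f\<close>\<close>

locale category =
  fixes C :: "('o, 'm) cat"
  assumes src_obj: "f \<in> arr C \<Longrightarrow> src C f \<in> obj C"
    and tgt_obj: "f \<in> arr C \<Longrightarrow> tgt C f \<in> obj C"
    and ident_arr: "a \<in> obj C \<Longrightarrow> ident C a \<in> arr C \<and> src C (ident C a) = a \<and> tgt C (ident C a) = a"
    and cmp_arr: "\<lbrakk>f \<in> arr C; g \<in> arr C; tgt C f = src C g\<rbrakk> \<Longrightarrow>
        cmp C g f \<in> arr C \<and> src C (cmp C g f) = src C f \<and> tgt C (cmp C g f) = tgt C g"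
    and cmp_ident_right: "f \<in> arr C \<Longrightarrow> cmp C f (ident C (src C f)) = f"
    and cmp_ident_left: "f \<in> arr C \<Longrightarrow> cmp C (ident C (tgt C f)) f = f"
    and cmp_assoc: "\<lbrakk>f \<in> arr C; g \<in> arr C; h \<in> arr C; tgt C f = src C g; tgt C g = src C h\<rbrakk> \<Longrightarrow>
        cmp C (cmp C h g) f = cmp C h (cmp C g f)"

definition hom :: "('o, 'm) cat \<Rightarrow> 'o \<Rightarrow> 'o \<Rightarrow> 'm set" where
  "hom C a b = {f \<in> arr C. src C f = a \<and> tgt C f = b}"

definition is_terminal :: "('o, 'm) cat \<Rightarrow> 'o \<Rightarrow> bool" where
  "is_terminal C t \<longleftrightarrow> t \<in> obj C \<and> (\<forall>a\<in>obj C. \<exists>!f. f \<in> hom C a t)"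

definition is_product :: "('o, 'm) cat \<Rightarrow> 'o \<Rightarrow> 'o \<Rightarrow> 'm \<Rightarrow> 'm \<Rightarrow> bool" where
  "is_product C a b p q \<longleftrightarrow>
     p \<in> arr C \<and> q \<in> arr C \<and> src C p = src C q \<and> tgt C p = a \<and> tgt C q = b \<and>
     (\<forall>d\<in>obj C. \<forall>f\<in>hom C d a. \<forall>g\<in>hom C d b.
        \<exists>!h. h \<in> hom C d (src C p) \<and> cmp C p h = f \<and> cmp C q h = g)"

definition has_finite_products :: "('o, 'm) cat \<Rightarrow> bool" where
  "has_finite_products C \<longleftrightarrow>
     (\<exists>t. is_terminal C t) \<and> (\<forall>a\<in>obj C. \<forall>b\<in>obj C. \<exists>p q. is_product C a b p q)"

text \<open>For \<open>u: A' \<rightarrow> A\<close> and \<open>g: C \<rightarrow> A\<close>, the first projection \<open>p\<close> goes to \<open>A'\<close> and the second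
  projection \<open>q\<close> to \<open>C\<close>, i.e.\ \<open>p\<close> is \<open>u\<close>*\<open>g\<close> and \<open>q\<close> is \<open>g\<close>*\<open>u\<close>.\<close>

definition is_pullback :: "('o, 'm) cat \<Rightarrow> 'm \<Rightarrow> 'm \<Rightarrow> 'm \<Rightarrow> 'm \<Rightarrow> bool" where
  "is_pullback C u g p q \<longleftrightarrow>
     u \<in> arr C \<and> g \<in> arr C \<and> tgt C u = tgt C g \<and>
     p \<in> arr C \<and> q \<in> arr C \<and> src C p = src C q \<and> tgt C p = src C u \<and> tgt C q = src C g \<and>
     cmp C u p = cmp C g q \<and>
     (\<forall>d\<in>obj C. \<forall>p'\<in>hom C d (src C u). \<forall>q'\<in>hom C d (src C g).
        cmp C u p' = cmp C g q' \<longrightarrow>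
        (\<exists>!h. h \<in> hom C d (src C p) \<and> cmp C p h = p' \<and> cmp C q h = q'))"

definition has_pullbacks :: "('o, 'm) cat \<Rightarrow> bool" where
  "has_pullbacks C \<longleftrightarrow>
     (\<forall>u\<in>arr C. \<forall>g\<in>arr C. tgt C u = tgt C g \<longrightarrow> (\<exists>p q. is_pullback C u g p q))"

definition pullback :: "('o, 'm) cat \<Rightarrow> 'm \<Rightarrow> 'm \<Rightarrow> 'm \<times> 'm" where
  "pullback C u g = (SOME pq. is_pullback C u g (fst pq) (snd pq))"


section \<open>Poset reflection of a preorder\<close>

definition refl_class :: "'x set \<Rightarrow> ('x \<Rightarrow> 'x \<Rightarrow> bool) \<Rightarrow> 'x \<Rightarrow> 'x set" where
  "refl_class S r x = {y \<in> S. r x y \<and> r y x}"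

definition poset_reflection :: "'x set \<Rightarrow> ('x \<Rightarrow> 'x \<Rightarrow> bool) \<Rightarrow> 'x set gorder" where
  "poset_reflection S r =
     \<lparr> carrier = refl_class S r ` S, eq = (=), le = (\<lambda>c d. \<exists>x\<in>c. \<exists>y\<in>d. r x y) \<rparr>"

text \<open>The map induced on classes by a monotone map \<open>F\<close> into the preorder \<open>(S, r)\<close>; all the classes
  in the union coincide.\<close>

definition refl_map :: "'y set \<Rightarrow> ('y \<Rightarrow> 'y \<Rightarrow> bool) \<Rightarrow> ('x \<Rightarrow> 'y) \<Rightarrow> 'x set \<Rightarrow> 'y set" where
  "refl_map S r F c = (\<Union>x\<in>c. refl_class S r (F x))"


section \<open>Doctrines\<close>

record ('o, 'm, 'p) doctrine =
  fib :: "'o \<Rightarrow> 'p gorder"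
  reindex :: "'m \<Rightarrow> 'p \<Rightarrow> 'p"

definition is_doctrine :: "('o, 'm) cat \<Rightarrow> ('o, 'm, 'p) doctrine \<Rightarrow> bool" where
  "is_doctrine C P \<longleftrightarrow>
     category C \<and> has_finite_products C \<and>
     (\<forall>a\<in>obj C. partial_order (fib P a)) \<and>
     (\<forall>u\<in>arr C. reindex P u \<in> carrier (fib P (tgt C u)) \<rightarrow> carrier (fib P (src C u)) \<and>
        isotone (fib P (tgt C u)) (fib P (src C u)) (reindex P u)) \<and>
     (\<forall>a\<in>obj C. \<forall>x\<in>carrier (fib P a). reindex P (ident C a) x = x) \<and>
     (\<forall>f\<in>arr C. \<forall>g\<in>arr C. tgt C f = src C g \<longrightarrow>
        (\<forall>x\<in>carrier (fib P (tgt C g)). reindex P (cmp C g f) x = reindex P f (reindex P g x)))"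

definition doctrine_iso ::
  "('o, 'm) cat \<Rightarrow> ('o, 'm, 'p) doctrine \<Rightarrow> ('o, 'm, 'q) doctrine \<Rightarrow> ('o \<Rightarrow> 'p \<Rightarrow> 'q) \<Rightarrow> bool" where
  "doctrine_iso C P Q \<eta> \<longleftrightarrow>
     (\<forall>a\<in>obj C. bij_betw (\<eta> a) (carrier (fib P a)) (carrier (fib Q a)) \<and>
        order_emb (fib P a) (fib Q a) (\<eta> a)) \<and>
     (\<forall>u\<in>arr C. \<forall>x\<in>carrier (fib P (tgt C u)).
        \<eta> (src C u) (reindex P u x) = reindex Q u (\<eta> (tgt C u) x))"

definition isomorphic_doctrines ::
  "('o, 'm) cat \<Rightarrow> ('o, 'm, 'p) doctrine \<Rightarrow> ('o, 'm, 'q) doctrine \<Rightarrow> bool" where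
  "isomorphic_doctrines C P Q \<longleftrightarrow>
     is_doctrine C P \<and> is_doctrine C Q \<and> (\<exists>\<eta>. doctrine_iso C P Q \<eta>)"


section \<open>The full universal completion\<close>

definition fuc_pairs :: "('o, 'm) cat \<Rightarrow> ('o, 'm, 'p) doctrine \<Rightarrow> 'o \<Rightarrow> ('m \<times> 'p) set" where
  "fuc_pairs C P a = {(f, \<alpha>). f \<in> arr C \<and> tgt C f = a \<and> \<alpha> \<in> carrier (fib P (src C f))}"

definition fuc_le ::
  "('o, 'm) cat \<Rightarrow> ('o, 'm, 'p) doctrine \<Rightarrow> 'm \<times> 'p \<Rightarrow> 'm \<times> 'p \<Rightarrow> bool" where
  "fuc_le C P = (\<lambda>(f, \<alpha>) (g, \<beta>).
     \<exists>h\<in>hom C (src C g) (src C f). cmp C f h = g \<and> reindex P h \<alpha> \<sqsubseteq>\<^bsub>fib P (src C g)\<^esub> \<beta>)"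

definition fuc_act ::
  "('o, 'm) cat \<Rightarrow> ('o, 'm, 'p) doctrine \<Rightarrow> 'm \<Rightarrow> 'm \<times> 'p \<Rightarrow> 'm \<times> 'p" where
  "fuc_act C P u = (\<lambda>(g, \<beta>). (fst (pullback C u g), reindex P (snd (pullback C u g)) \<beta>))"

definition full_universal_completion ::
  "('o, 'm) cat \<Rightarrow> ('o, 'm, 'p) doctrine \<Rightarrow> ('o, 'm, ('m \<times> 'p) set) doctrine" where
  "full_universal_completion C P =
     \<lparr> fib = (\<lambda>a. poset_reflection (fuc_pairs C P a) (fuc_le C P)),
       reindex = (\<lambda>u. refl_map (fuc_pairs C P (src C u)) (fuc_le C P) (fuc_act C P u)) \<rparr>"


section \<open>The category of sets\<close>

text \<open>The category Set is the full category of sets and functions on a family \<open>U\<close> of ``small'' sets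
  over an arbitrary type. Only the closure properties below are required of \<open>U\<close>; they hold in
  particular for the members of a Grothendieck universe, for all sets of a type of ZFC sets, and for
  all subsets of an infinite type. Products are only required up to bijection, since no
  pairing is fixed on the type.\<close>

locale set_universe =
  fixes U :: "'u set set"
  assumes singleton: "\<exists>x. {x} \<in> U"
    and subset: "\<lbrakk>X \<in> U; Y \<subseteq> X\<rbrakk> \<Longrightarrow> Y \<in> U"
    and product: "\<lbrakk>X \<in> U; Y \<in> U\<rbrakk> \<Longrightarrow> \<exists>Z\<in>U. \<exists>b. bij_betw b (X \<times> Y) Z"

lemma set_universe_UNIV:
  assumes "infinite (UNIV :: 'u set)"
  shows "set_universe (UNIV :: 'u set set)"
proof
  fix X Y :: "'u set"
  obtain b :: "'u \<times> 'u \<Rightarrow> 'u" where "bij b"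
    using card_of_Times_same_infinite[OF assms] card_of_ordIso by force
  then have "bij_betw b (X \<times> Y) (b ` (X \<times> Y))"
    by (meson bij_betw_subset subset_UNIV)
  then show "\<exists>Z\<in>(UNIV :: 'u set set). \<exists>b. bij_betw b (X \<times> Y) Z"
    by blast
qed auto

type_synonym 'u set_arr = "'u set \<times> ('u \<Rightarrow> 'u) \<times> 'u set"

text \<open>Arrows carry domain and codomain; functions are extensional, i.e.\ \<open>undefined\<close> outside their
  domain.\<close>

definition set_cat :: "'u set set \<Rightarrow> ('u set, 'u set_arr) cat" where
  "set_cat U =
     \<lparr> obj = U,
       arr = {(X, f, Y). X \<in> U \<and> Y \<in> U \<and> f \<in> X \<rightarrow>\<^sub>E Y},
       src = (\<lambda>(X, f, Y). X),
       tgt = (\<lambda>(X, f, Y). Y),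
       ident = (\<lambda>X. (X, (\<lambda>x\<in>X. x), X)),
       cmp = (\<lambda>(Y, g, Z) (X, f, Y'). (X, compose X g f, Z)) \<rparr>"


text \<open>So the chosen pullbacks used by the full universal completion do exist in Set.\<close>

lemma has_pullbacks_set_cat:
  assumes "set_universe U"
  shows "has_pullbacks (set_cat U)"
  unfolding has_pullbacks_def
proof (intro ballI impI)
  interpret set_universe U by fact
  fix u g assume u0: "u \<in> arr (set_cat U)" and g0: "g \<in> arr (set_cat U)"
    and t: "tgt (set_cat U) u = tgt (set_cat U) g"
  obtain A' f A where u: "u = (A', f, A)" by (cases u)
  obtain B k where g: "g = (B, k, A)" using t u by (cases g) (simp add: set_cat_def)
  have AU: "A' \<in> U" "A \<in> U" "B \<in> U" and f: "f \<in> A' \<rightarrow>\<^sub>E A" and k: "k \<in> B \<rightarrow>\<^sub>E A"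
    using u0 g0 by (auto simp: set_cat_def u g)
  obtain Z b where Z: "Z \<in> U" and b: "bij_betw b (A' \<times> B) Z"
    using product[OF AU(1,3)] by blast
  define c where "c = inv_into (A' \<times> B) b"
  have c: "c z \<in> A' \<times> B" "b (c z) = z" if "z \<in> Z" for z
    using b that unfolding c_def bij_betw_def by (auto intro: inv_into_into f_inv_into_f)
  have cb: "c (b w) = w" "b w \<in> Z" if "w \<in> A' \<times> B" for w
    using b that unfolding c_def bij_betw_def by auto
  define D where "D = {z \<in> Z. f (fst (c z)) = k (snd (c z))}"
  have D: "D \<in> U" "\<And>z. z \<in> D \<Longrightarrow> z \<in> Z"
    using subset[OF Z] by (auto simp: D_def)
  define p where "p = (D, (\<lambda>z\<in>D. fst (c z)), A')"
  define q where "q = (D, (\<lambda>z\<in>D. snd (c z)), B)"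
  have pE: "(\<lambda>z\<in>D. fst (c z)) \<in> D \<rightarrow>\<^sub>E A'" and qE: "(\<lambda>z\<in>D. snd (c z)) \<in> D \<rightarrow>\<^sub>E B"
    using c D(2) by (auto simp: mem_Times_iff)
  have sq: "compose D f (\<lambda>z\<in>D. fst (c z)) = compose D k (\<lambda>z\<in>D. snd (c z))"
    by (auto simp: compose_def fun_eq_iff D_def)
  have univ: "\<exists>!h. h \<in> hom (set_cat U) E (src (set_cat U) p) \<and>
      cmp (set_cat U) p h = p' \<and> cmp (set_cat U) q h = q'"
    if E: "E \<in> U" and p': "p' \<in> hom (set_cat U) E A'" and q': "q' \<in> hom (set_cat U) E B"
      and eq: "cmp (set_cat U) u p' = cmp (set_cat U) g q'" for E p' q'
  proof -
    obtain r where r: "p' = (E, r, A')" "r \<in> E \<rightarrow>\<^sub>E A'"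
      using p' by (auto simp: hom_def set_cat_def)
    obtain s where s: "q' = (E, s, B)" "s \<in> E \<rightarrow>\<^sub>E B"
      using q' by (auto simp: hom_def set_cat_def)
    have rs: "f (r e) = k (s e)" "(r e, s e) \<in> A' \<times> B" if "e \<in> E" for e
    proof -
      have "compose E f r = compose E k s"
        using eq by (simp add: set_cat_def u g r s)
      then show "f (r e) = k (s e)" using that by (metis compose_eq)
      show "(r e, s e) \<in> A' \<times> B" using r s that by auto
    qed
    have hD: "b (r e, s e) \<in> D" if "e \<in> E" for e
      using rs[OF that] cb[OF rs(2)[OF that]] by (simp add: D_def)
    show ?thesis
    proof (rule ex1I)
      show "(E, (\<lambda>e\<in>E. b (r e, s e)), D) \<in> hom (set_cat U) E (src (set_cat U) p) \<and>
        cmp (set_cat U) p (E, (\<lambda>e\<in>E. b (r e, s e)), D) = p' \<and>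
        cmp (set_cat U) q (E, (\<lambda>e\<in>E. b (r e, s e)), D) = q'"
        using E D(1) hD r s cb(1)[OF rs(2)]
        by (auto simp: hom_def set_cat_def p_def q_def compose_def fun_eq_iff PiE_def extensional_def)
    next
      fix h assume h: "h \<in> hom (set_cat U) E (src (set_cat U) p) \<and>
        cmp (set_cat U) p h = p' \<and> cmp (set_cat U) q h = q'"
      then obtain m where m: "h = (E, m, D)" "m \<in> E \<rightarrow>\<^sub>E D"
        by (auto simp: hom_def set_cat_def p_def)
      have me: "m e = b (r e, s e)" if e: "e \<in> E" for e
      proof -
        have mD: "m e \<in> D" using m e by auto
        have "compose E (\<lambda>z\<in>D. fst (c z)) m = r" "compose E (\<lambda>z\<in>D. snd (c z)) m = s"
          using h by (simp_all add: set_cat_def p_def q_def m r s)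
        then have "fst (c (m e)) = r e" "snd (c (m e)) = s e"
          using e mD by (auto simp: compose_def fun_eq_iff split: if_splits)
        then have "c (m e) = (r e, s e)" by (simp add: prod_eq_iff)
        then show ?thesis using c(2) D(2)[OF mD] by metis
      qed
      have "m = (\<lambda>e\<in>E. b (r e, s e))"
        using m(2) me by (intro extensionalityI[of _ E]) (auto simp: PiE_def)
      then show "h = (E, (\<lambda>e\<in>E. b (r e, s e)), D)" using m(1) by simp
    qed
  qed
  have "is_pullback (set_cat U) u g p q"
    unfolding is_pullback_def
  proof (intro conjI ballI impI)
    show "cmp (set_cat U) u p = cmp (set_cat U) g q"
      using sq by (simp add: set_cat_def u g p_def q_def)
  next
    fix d p' q'
    assume "d \<in> obj (set_cat U)" "p' \<in> hom (set_cat U) d (src (set_cat U) u)"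
      "q' \<in> hom (set_cat U) d (src (set_cat U) g)"
      "cmp (set_cat U) u p' = cmp (set_cat U) g q'"
    then show "\<exists>!h. h \<in> hom (set_cat U) d (src (set_cat U) p) \<and>
        cmp (set_cat U) p h = p' \<and> cmp (set_cat U) q h = q'"
      using univ[of d p' q'] by (simp add: set_cat_def u g)
  qed (use u0 g0 AU D pE qE in \<open>auto simp: set_cat_def u g p_def q_def\<close>)
  then show "\<exists>p q. is_pullback (set_cat U) u g p q" by blast
qed


section \<open>Muchnik doctrines\<close>

definition dw_le ::
  "('a \<Rightarrow> 'a \<Rightarrow> 'a option) \<Rightarrow> 'a set \<Rightarrow> 'x set \<Rightarrow> ('x \<Rightarrow> 'a) \<Rightarrow> ('x \<Rightarrow> 'a) \<Rightarrow> bool" where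
  "dw_le app A' X \<alpha> \<beta> \<longleftrightarrow> (\<forall>x\<in>X. \<exists>a\<in>A'. app a (\<beta> x) = Some (\<alpha> x))"

definition w_le ::
  "('a \<Rightarrow> 'a \<Rightarrow> 'a option) \<Rightarrow> 'a set \<Rightarrow> 'x set \<Rightarrow> ('x \<Rightarrow> 'a set) \<Rightarrow> ('x \<Rightarrow> 'a set) \<Rightarrow> bool" where
  "w_le app A' X \<phi> \<psi> \<longleftrightarrow>
     (\<forall>x\<in>X. \<forall>b\<in>\<psi> x. \<exists>a\<in>A'. \<exists>c. app a b = Some c \<and> c \<in> \<phi> x)"

definition muchnik_singletons ::
  "'a set \<Rightarrow> ('a \<Rightarrow> 'a \<Rightarrow> 'a option) \<Rightarrow> 'a set \<Rightarrow> ('u set, 'u set_arr, ('u \<Rightarrow> 'a) set) doctrine" where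
  "muchnik_singletons A app A' =
     \<lparr> fib = (\<lambda>X. poset_reflection (X \<rightarrow>\<^sub>E A) (dw_le app A' X)),
       reindex = (\<lambda>(Y, u, X). refl_map (Y \<rightarrow>\<^sub>E A) (dw_le app A' Y) (\<lambda>\<alpha>. compose Y \<alpha> u)) \<rparr>"

definition muchnik ::
  "'a set \<Rightarrow> ('a \<Rightarrow> 'a \<Rightarrow> 'a option) \<Rightarrow> 'a set \<Rightarrow> ('u set, 'u set_arr, ('u \<Rightarrow> 'a set) set) doctrine" where
  "muchnik A app A' =
     \<lparr> fib = (\<lambda>X. poset_reflection (X \<rightarrow>\<^sub>E Pow A) (w_le app A' X)),
       reindex = (\<lambda>(Y, u, X). refl_map (Y \<rightarrow>\<^sub>E Pow A) (w_le app A' Y) (\<lambda>\<phi>. compose Y \<phi> u)) \<rparr>"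

end

theory Submission
  imports Defs
begin

text \<open>A pair \<open>(f: B \<rightarrow> X, \<alpha>: B \<rightarrow> A)\<close> is sent to the family \<open>x \<mapsto> \<alpha>(f\<inverse>(x))\<close> of subsets of \<open>A\<close>.
  Choosing for every \<open>c\<close> a suitable \<open>b\<close> in the fibre over \<open>g(c)\<close> shows that this preserves and
  reflects the preorders. Every family \<open>\<phi>\<close> arises from the projection of
  \<open>{(x, a). a \<in> \<phi>(x)}\<close> to \<open>X\<close>, and pulling a pair back along \<open>u\<close> precomposes its
  family with \<open>u\<close>. So it is an equivalence of preorders natural up to equivalence, hence an
  isomorphism on the poset reflections. That the completion is a doctrine is transported along it.\<close>

section \<open>Poset reflections\<close>

lemma refl_class_eq_iff:
  assumes "reflp_on S r" "transp_on S r" "x \<in> S" "y \<in> S"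
  shows "refl_class S r x = refl_class S r y \<longleftrightarrow> r x y \<and> r y x"
proof
  assume "refl_class S r x = refl_class S r y"
  moreover have "x \<in> refl_class S r x"
    using assms by (auto simp: refl_class_def dest: reflp_onD)
  ultimately show "r x y \<and> r y x"
    by (auto simp: refl_class_def)
next
  assume "r x y \<and> r y x"
  then show "refl_class S r x = refl_class S r y"
    using assms unfolding refl_class_def by (blast dest: transp_onD)
qed

lemma mem_refl_class: "reflp_on S r \<Longrightarrow> x \<in> S \<Longrightarrow> x \<in> refl_class S r x"
  by (auto simp: refl_class_def dest: reflp_onD)

text \<open>The order of \<open>poset_reflection\<close> asks only for some related pair of
  representatives. Transitivity moves that relation to any other pair, so the order can be tested on
  the representatives at hand.\<close>

lemma le_poset_reflection_iff:
  assumes "reflp_on S r" "transp_on S r" "x \<in> S" "y \<in> S"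
  shows "refl_class S r x \<sqsubseteq>\<^bsub>poset_reflection S r\<^esub> refl_class S r y \<longleftrightarrow> r x y"
proof
  assume "refl_class S r x \<sqsubseteq>\<^bsub>poset_reflection S r\<^esub> refl_class S r y"
  then obtain x' y' where "x' \<in> S" "y' \<in> S" "r x x'" "r x' y'" "r y' y"
    by (auto simp: poset_reflection_def refl_class_def)
  then show "r x y"
    using assms by (meson transp_onD)
next
  assume "r x y"
  then show "refl_class S r x \<sqsubseteq>\<^bsub>poset_reflection S r\<^esub> refl_class S r y"
    using assms mem_refl_class by (fastforce simp: poset_reflection_def)
qed

lemma carrier_poset_reflection: "carrier (poset_reflection S r) = refl_class S r ` S"
  by (simp add: poset_reflection_def)

lemma partial_order_poset_reflection:
  assumes r: "reflp_on S r" "transp_on S r"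
  shows "partial_order (poset_reflection S r)"
proof
  show "(.=\<^bsub>poset_reflection S r\<^esub>) = (=)"
    by (simp add: poset_reflection_def)
next
  fix c d assume c: "c \<in> carrier (poset_reflection S r)" and d: "d \<in> carrier (poset_reflection S r)"
    and le: "c \<sqsubseteq>\<^bsub>poset_reflection S r\<^esub> d" "d \<sqsubseteq>\<^bsub>poset_reflection S r\<^esub> c"
  obtain x y where xy: "x \<in> S" "y \<in> S" "c = refl_class S r x" "d = refl_class S r y"
    using c d by (auto simp: carrier_poset_reflection)
  then have "c = d"
    using le r by (simp add: le_poset_reflection_iff refl_class_eq_iff)
  then show "c .=\<^bsub>poset_reflection S r\<^esub> d"
    by (simp add: poset_reflection_def)
next
  fix c d e assume c: "c \<in> carrier (poset_reflection S r)" "d \<in> carrier (poset_reflection S r)"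
      "e \<in> carrier (poset_reflection S r)"
    and le: "c \<sqsubseteq>\<^bsub>poset_reflection S r\<^esub> d" "d \<sqsubseteq>\<^bsub>poset_reflection S r\<^esub> e"
  obtain x y z where xyz: "x \<in> S" "y \<in> S" "z \<in> S"
      "c = refl_class S r x" "d = refl_class S r y" "e = refl_class S r z"
    using c by (auto simp: carrier_poset_reflection)
  then show "c \<sqsubseteq>\<^bsub>poset_reflection S r\<^esub> e"
    using le r by (simp add: le_poset_reflection_iff) (meson transp_onD)
next
  fix c assume "c \<in> carrier (poset_reflection S r)"
  then show "c \<sqsubseteq>\<^bsub>poset_reflection S r\<^esub> c"
    using r by (auto simp: carrier_poset_reflection le_poset_reflection_iff dest: reflp_onD)
qed (simp_all add: poset_reflection_def)

text \<open>A monotone map preserves equivalence, so every class joined in \<open>refl_map\<close>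
  is already the class of \<open>F x\<close>. This lets reindexing be computed on a single
  representative.\<close>

lemma refl_map_refl_class:
  assumes "reflp_on S r" "transp_on S r" "reflp_on T t" "transp_on T t"
    and "F \<in> S \<rightarrow> T" and mono: "\<And>x y. x \<in> S \<Longrightarrow> y \<in> S \<Longrightarrow> r x y \<Longrightarrow> t (F x) (F y)"
    and x: "x \<in> S"
  shows "refl_map T t F (refl_class S r x) = refl_class T t (F x)"
proof -
  have "refl_class T t (F y) = refl_class T t (F x)" if "y \<in> refl_class S r x" for y
    using that assms by (subst refl_class_eq_iff) (auto simp: refl_class_def)
  moreover have "x \<in> refl_class S r x"
    using assms mem_refl_class by fast
  ultimately show ?thesis
    unfolding refl_map_def by blast
qed


section \<open>Doctrines from indexed preorders\<close>

text \<open>The identity and composition laws of \<open>act\<close> are equations, not equivalences.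
  Precomposition satisfies them strictly, whereas chosen pullbacks compose only up to isomorphism;
  so the locale models the Muchnik side, and the completion is compared with it.\<close>

locale indexed_preorder = category C
  for C :: "('o, 'm) cat" +
  fixes T :: "'o \<Rightarrow> 'y set" and t :: "'o \<Rightarrow> 'y \<Rightarrow> 'y \<Rightarrow> bool" and act :: "'m \<Rightarrow> 'y \<Rightarrow> 'y"
  assumes reflp: "a \<in> obj C \<Longrightarrow> reflp_on (T a) (t a)"
    and transp: "a \<in> obj C \<Longrightarrow> transp_on (T a) (t a)"
    and act_closed: "u \<in> arr C \<Longrightarrow> act u \<in> T (tgt C u) \<rightarrow> T (src C u)"
    and act_mono: "\<lbrakk>u \<in> arr C; x \<in> T (tgt C u); y \<in> T (tgt C u); t (tgt C u) x y\<rbrakk> \<Longrightarrow>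
      t (src C u) (act u x) (act u y)"
    and act_ident: "a \<in> obj C \<Longrightarrow> x \<in> T a \<Longrightarrow> act (ident C a) x = x"
    and act_cmp: "\<lbrakk>f \<in> arr C; g \<in> arr C; tgt C f = src C g; x \<in> T (tgt C g)\<rbrakk> \<Longrightarrow>
      act (cmp C g f) x = act f (act g x)"
begin

definition reflected_doctrine :: "('o, 'm, 'y set) doctrine" where
  "reflected_doctrine =
     \<lparr> fib = (\<lambda>a. poset_reflection (T a) (t a)),
       reindex = (\<lambda>u. refl_map (T (src C u)) (t (src C u)) (act u)) \<rparr>"

lemma reindex_refl_class:
  assumes "u \<in> arr C" "x \<in> T (tgt C u)"
  shows "reindex reflected_doctrine u (refl_class (T (tgt C u)) (t (tgt C u)) x)
    = refl_class (T (src C u)) (t (src C u)) (act u x)"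
  unfolding reflected_doctrine_def doctrine.simps
  using assms by (intro refl_map_refl_class reflp transp src_obj tgt_obj act_closed act_mono)

lemma is_doctrine_reflected:
  assumes "has_finite_products C"
  shows "is_doctrine C reflected_doctrine"
proof -
  have fib: "fib reflected_doctrine a = poset_reflection (T a) (t a)" for a
    by (simp add: reflected_doctrine_def)
  have po: "partial_order (fib reflected_doctrine a)" if "a \<in> obj C" for a
    using that by (simp add: fib partial_order_poset_reflection reflp transp)
  have closed: "reindex reflected_doctrine u \<in>
      carrier (fib reflected_doctrine (tgt C u)) \<rightarrow> carrier (fib reflected_doctrine (src C u))"
    if "u \<in> arr C" for u
    using that act_closed[OF that] by (auto simp: fib carrier_poset_reflection reindex_refl_class)
  have mono: "isotone (fib reflected_doctrine (tgt C u)) (fib reflected_doctrine (src C u))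
      (reindex reflected_doctrine u)" if u: "u \<in> arr C" for u
    unfolding isotone_def
  proof (intro conjI ballI impI)
    show "weak_partial_order (fib reflected_doctrine (tgt C u))"
      "weak_partial_order (fib reflected_doctrine (src C u))"
      using u by (simp_all add: po partial_order.axioms src_obj tgt_obj)
  next
    fix c d assume "c \<in> carrier (fib reflected_doctrine (tgt C u))"
      "d \<in> carrier (fib reflected_doctrine (tgt C u))" "c \<sqsubseteq>\<^bsub>fib reflected_doctrine (tgt C u)\<^esub> d"
    then show "reindex reflected_doctrine u c
        \<sqsubseteq>\<^bsub>fib reflected_doctrine (src C u)\<^esub> reindex reflected_doctrine u d"
      using u act_closed[OF u] act_mono[OF u]
      by (auto simp: fib carrier_poset_reflection reindex_refl_class src_obj tgt_obj reflp transp
          le_poset_reflection_iff Pi_iff)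
  qed
  have ident: "reindex reflected_doctrine (ident C a) c = c"
    if "a \<in> obj C" "c \<in> carrier (fib reflected_doctrine a)" for a c
    using that ident_arr[OF that(1)] reindex_refl_class[of "ident C a"]
    by (auto simp: fib carrier_poset_reflection act_ident)
  have comp: "reindex reflected_doctrine (cmp C g f) c
      = reindex reflected_doctrine f (reindex reflected_doctrine g c)"
    if fg: "f \<in> arr C" "g \<in> arr C" "tgt C f = src C g"
      and c: "c \<in> carrier (fib reflected_doctrine (tgt C g))" for f g c
  proof -
    obtain x where x: "x \<in> T (tgt C g)" "c = refl_class (T (tgt C g)) (t (tgt C g)) x"
      using c by (auto simp: fib carrier_poset_reflection)
    have "act g x \<in> T (tgt C f)"
      using act_closed[OF fg(2)] x fg(3) by auto
    then show ?thesis
      using x fg cmp_arr[OF fg] reindex_refl_class[of "cmp C g f" x] reindex_refl_class[of g x]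
        reindex_refl_class[of f "act g x"]
      by (simp add: act_cmp)
  qed
  show ?thesis
    unfolding is_doctrine_def using assms category_axioms po closed mono ident comp by blast
qed

end

section \<open>Doctrine structure and isomorphisms from fibrewise equivalences of preorders\<close>

text \<open>Every element of a fibre of \<open>Q\<close> is an image under \<eta>, so naturality
  turns each law of reindexing in \<open>Q\<close> into the same law in \<open>P\<close>. For the
  completion this replaces a direct check that chosen pullbacks respect identities and
  composition.\<close>

lemma is_doctrine_transport:
  assumes P: "is_doctrine C P" and iso: "doctrine_iso C P Q \<eta>"
    and po: "\<And>a. a \<in> obj C \<Longrightarrow> partial_order (fib Q a)"
  shows "is_doctrine C Q"
proof -
  interpret category C
    using P by (simp add: is_doctrine_def)
  have bij: "bij_betw (\<eta> a) (carrier (fib P a)) (carrier (fib Q a))"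
    and emb: "\<And>x y. x \<in> carrier (fib P a) \<Longrightarrow> y \<in> carrier (fib P a) \<Longrightarrow>
      \<eta> a x \<sqsubseteq>\<^bsub>fib Q a\<^esub> \<eta> a y \<longleftrightarrow> x \<sqsubseteq>\<^bsub>fib P a\<^esub> y" if "a \<in> obj C" for a
    using iso that by (auto simp: doctrine_iso_def order_emb_def)
  have nat: "reindex Q u (\<eta> (tgt C u) x) = \<eta> (src C u) (reindex P u x)"
    if "u \<in> arr C" "x \<in> carrier (fib P (tgt C u))" for u x
    using iso that by (simp add: doctrine_iso_def)
  have lift: "\<exists>x\<in>carrier (fib P a). y = \<eta> a x" if "a \<in> obj C" "y \<in> carrier (fib Q a)" for a y
    using bij[OF that(1)] that(2) by (auto simp: bij_betw_def)
  have maps: "\<eta> a x \<in> carrier (fib Q a)" if "a \<in> obj C" "x \<in> carrier (fib P a)" for a x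
    using bij[OF that(1)] that(2) by (auto simp: bij_betw_def)
  have Pr: "reindex P u x \<in> carrier (fib P (src C u))"
    if "u \<in> arr C" "x \<in> carrier (fib P (tgt C u))" for u x
    using P that by (auto simp: is_doctrine_def)
  have Pm: "reindex P u x \<sqsubseteq>\<^bsub>fib P (src C u)\<^esub> reindex P u y"
    if "u \<in> arr C" "x \<in> carrier (fib P (tgt C u))" "y \<in> carrier (fib P (tgt C u))"
      "x \<sqsubseteq>\<^bsub>fib P (tgt C u)\<^esub> y" for u x y
    using P that by (auto simp: is_doctrine_def isotone_def)
  have closed: "reindex Q u \<in> carrier (fib Q (tgt C u)) \<rightarrow> carrier (fib Q (src C u))"
    if u: "u \<in> arr C" for u
  proof
    fix y assume "y \<in> carrier (fib Q (tgt C u))"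
    then obtain x where "x \<in> carrier (fib P (tgt C u))" "y = \<eta> (tgt C u) x"
      using lift u tgt_obj by blast
    then show "reindex Q u y \<in> carrier (fib Q (src C u))"
      using u by (simp add: nat maps Pr src_obj)
  qed
  have mono: "isotone (fib Q (tgt C u)) (fib Q (src C u)) (reindex Q u)" if u: "u \<in> arr C" for u
    unfolding isotone_def
  proof (intro conjI ballI impI)
    show "weak_partial_order (fib Q (tgt C u))" "weak_partial_order (fib Q (src C u))"
      using u by (simp_all add: po partial_order.axioms src_obj tgt_obj)
  next
    fix y y' assume y: "y \<in> carrier (fib Q (tgt C u))" "y' \<in> carrier (fib Q (tgt C u))"
      "y \<sqsubseteq>\<^bsub>fib Q (tgt C u)\<^esub> y'"
    then obtain x x' where "x \<in> carrier (fib P (tgt C u))" "y = \<eta> (tgt C u) x"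
      "x' \<in> carrier (fib P (tgt C u))" "y' = \<eta> (tgt C u) x'"
      using lift u tgt_obj by meson
    then show "reindex Q u y \<sqsubseteq>\<^bsub>fib Q (src C u)\<^esub> reindex Q u y'"
      using y u by (simp add: nat emb Pr Pm src_obj tgt_obj)
  qed
  have ident: "reindex Q (ident C a) y = y" if a: "a \<in> obj C" "y \<in> carrier (fib Q a)" for a y
  proof -
    obtain x where x: "x \<in> carrier (fib P a)" "y = \<eta> a x"
      using lift a by blast
    have "reindex P (ident C a) x = x"
      using P a x by (simp add: is_doctrine_def)
    then show ?thesis
      using nat[of "ident C a" x] x ident_arr[OF a(1)] by simp
  qed
  have comp: "reindex Q (cmp C g f) y = reindex Q f (reindex Q g y)"
    if fg: "f \<in> arr C" "g \<in> arr C" "tgt C f = src C g" and y: "y \<in> carrier (fib Q (tgt C g))"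
    for f g y
  proof -
    obtain x where x: "x \<in> carrier (fib P (tgt C g))" "y = \<eta> (tgt C g) x"
      using lift y fg tgt_obj by blast
    have "reindex P (cmp C g f) x = reindex P f (reindex P g x)"
      using P fg x by (simp add: is_doctrine_def)
    then show ?thesis
      using nat[of "cmp C g f" x] nat[of g x] nat[of f "reindex P g x"] x Pr[of g x] fg
        cmp_arr[OF fg] by simp
  qed
  show ?thesis
    unfolding is_doctrine_def using P[unfolded is_doctrine_def] po closed mono ident comp by blast
qed

text \<open>On each fibre \<open>G\<close> is an equivalence of preorders, and it commutes with the
  actions up to equivalence; both become exact on classes. Monotonicity of \<open>actS\<close>, and
  its functoriality on classes, are inherited from \<open>act\<close> through
  \<open>G\<close>.\<close>

lemma (in indexed_preorder) isomorphic_reflected_doctrine: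
  fixes S :: "'o \<Rightarrow> 'x set" and actS :: "'m \<Rightarrow> 'x \<Rightarrow> 'x"
  assumes prod: "has_finite_products C"
    and G: "\<And>a. a \<in> obj C \<Longrightarrow> G a \<in> S a \<rightarrow> T a"
    and emb: "\<And>a x y. a \<in> obj C \<Longrightarrow> x \<in> S a \<Longrightarrow> y \<in> S a \<Longrightarrow>
      r a x y \<longleftrightarrow> t a (G a x) (G a y)"
    and surj: "\<And>a y. a \<in> obj C \<Longrightarrow> y \<in> T a \<Longrightarrow>
      \<exists>x\<in>S a. t a (G a x) y \<and> t a y (G a x)"
    and actS: "\<And>u. u \<in> arr C \<Longrightarrow> actS u \<in> S (tgt C u) \<rightarrow> S (src C u)"
    and nat: "\<And>u x. u \<in> arr C \<Longrightarrow> x \<in> S (tgt C u) \<Longrightarrow>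
      t (src C u) (G (src C u) (actS u x)) (act u (G (tgt C u) x)) \<and>
      t (src C u) (act u (G (tgt C u) x)) (G (src C u) (actS u x))"
  shows "isomorphic_doctrines C reflected_doctrine
    \<lparr> fib = (\<lambda>a. poset_reflection (S a) (r a)),
      reindex = (\<lambda>u. refl_map (S (src C u)) (r (src C u)) (actS u)) \<rparr>"
    (is "isomorphic_doctrines C ?P ?Q")
proof -
  have rS: "reflp_on (S a) (r a)" if "a \<in> obj C" for a
    using reflp[OF that] G[OF that] emb[OF that] by (auto simp: reflp_on_def)
  have tS: "transp_on (S a) (r a)" if a: "a \<in> obj C" for a
  proof (rule transp_onI)
    fix x y z assume "x \<in> S a" "y \<in> S a" "z \<in> S a" "r a x y" "r a y z"
    then show "r a x z"
      using transp_onD[OF transp[OF a], of "G a x" "G a y" "G a z"] G[OF a] emb[OF a] by auto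
  qed
  \<comment> \<open>Taking preimages under \<open>G a\<close> defines the map on classes without
    choosing representatives. The class of \<open>G a x\<close> goes to the class of
    \<open>x\<close> because \<open>G a\<close> preserves and reflects the preorder.\<close>
  define \<eta> where "\<eta> a c = {x \<in> S a. G a x \<in> c}" for a c
  have \<eta>: "\<eta> a (refl_class (T a) (t a) (G a x)) = refl_class (S a) (r a) x"
    if "a \<in> obj C" "x \<in> S a" for a x
    using that G[OF that(1)] emb[OF that(1)] by (auto simp: \<eta>_def refl_class_def)
  \<comment> \<open>By essential surjectivity every class of \<open>T a\<close> contains a value of
    \<open>G a\<close>, so it is enough to know \<eta> on the classes of such values.\<close>
  have carrP: "carrier (fib ?P a) = (\<lambda>x. refl_class (T a) (t a) (G a x)) ` S a"
    if a: "a \<in> obj C" for a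
  proof -
    have "refl_class (T a) (t a) y \<in> (\<lambda>x. refl_class (T a) (t a) (G a x)) ` S a"
      if y: "y \<in> T a" for y
    proof -
      obtain x where x: "x \<in> S a" "t a (G a x) y \<and> t a y (G a x)"
        using surj a y by blast
      then have "refl_class (T a) (t a) (G a x) = refl_class (T a) (t a) y"
        using G[OF a] y by (subst refl_class_eq_iff[OF reflp[OF a] transp[OF a]]) auto
      then show ?thesis using x by blast
    qed
    then show ?thesis
      using G[OF a] by (auto simp: reflected_doctrine_def carrier_poset_reflection)
  qed
  have carrQ: "carrier (fib ?Q a) = refl_class (S a) (r a) ` S a" for a
    by (simp add: carrier_poset_reflection)
  have eq: "refl_class (T a) (t a) (G a x) = refl_class (T a) (t a) (G a y) \<longleftrightarrow>
      refl_class (S a) (r a) x = refl_class (S a) (r a) y"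
    if a: "a \<in> obj C" and "x \<in> S a" "y \<in> S a" for a x y
    using that G[OF a] emb[OF a]
    by (subst (1 2) refl_class_eq_iff) (auto simp: reflp transp rS tS)
  have le: "refl_class (T a) (t a) (G a x) \<sqsubseteq>\<^bsub>fib ?P a\<^esub> refl_class (T a) (t a) (G a y) \<longleftrightarrow>
      refl_class (S a) (r a) x \<sqsubseteq>\<^bsub>fib ?Q a\<^esub> refl_class (S a) (r a) y"
    if a: "a \<in> obj C" and "x \<in> S a" "y \<in> S a" for a x y
    using that G[OF a] emb[OF a] reflp[OF a] transp[OF a] rS[OF a] tS[OF a]
    by (simp add: reflected_doctrine_def le_poset_reflection_iff Pi_iff)
  have bij: "bij_betw (\<eta> a) (carrier (fib ?P a)) (carrier (fib ?Q a))" if a: "a \<in> obj C" for a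
    unfolding carrP[OF a] carrQ using \<eta>[OF a] eq[OF a]
    by (auto simp: bij_betw_def inj_on_def image_image)
  have order: "order_emb (fib ?P a) (fib ?Q a) (\<eta> a)" if a: "a \<in> obj C" for a
    unfolding order_emb_def
  proof (intro conjI ballI)
    show "weak_partial_order (fib ?P a)" "weak_partial_order (fib ?Q a)"
      using a by (simp_all add: reflected_doctrine_def partial_order_poset_reflection
          partial_order.axioms reflp transp rS tS)
  qed (use \<eta>[OF a] le[OF a] in \<open>auto simp: carrP[OF a]\<close>)
  have natural: "\<eta> (src C u) (reindex ?P u c) = reindex ?Q u (\<eta> (tgt C u) c)"
    if u: "u \<in> arr C" and c: "c \<in> carrier (fib ?P (tgt C u))" for u c
  proof -
    define a b where "a = tgt C u" and "b = src C u"
    have ab: "a \<in> obj C" "b \<in> obj C"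
      using u by (simp_all add: a_def b_def src_obj tgt_obj)
    have GT: "G a y \<in> T a" "act u (G a y) \<in> T b" "G b (actS u y) \<in> T b" "actS u y \<in> S b"
      if "y \<in> S a" for y
      using that G[OF ab(1)] G[OF ab(2)] act_closed[OF u] actS[OF u] by (auto simp: a_def b_def)
    have nat': "t b (G b (actS u y)) (act u (G a y))" "t b (act u (G a y)) (G b (actS u y))"
      if "y \<in> S a" for y
      using nat[OF u, of y] that by (auto simp: a_def b_def)
    \<comment> \<open>The inequality is known for \<open>act u\<close> on the images under
      \<open>G a\<close>. It is carried along the equivalences of naturality and then reflected by
      \<open>G b\<close>.\<close>
    have mono: "r b (actS u y) (actS u z)" if yz: "y \<in> S a" "z \<in> S a" "r a y z" for y z
    proof -
      have "t b (act u (G a y)) (act u (G a z))"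
        using yz act_mono[OF u] GT emb[OF ab(1)] by (simp add: a_def b_def)
      then have "t b (G b (actS u y)) (G b (actS u z))"
        using transp[OF ab(2)] nat' GT yz by (meson transp_onD)
      then show ?thesis
        using emb[OF ab(2)] GT yz by blast
    qed
    obtain x where x: "x \<in> S a" "c = refl_class (T a) (t a) (G a x)"
      using c ab by (auto simp: a_def carrP)
    have "reindex ?P u c = refl_class (T b) (t b) (act u (G a x))"
      using reindex_refl_class[OF u, of "G a x"] x GT by (simp add: a_def b_def)
    also have "\<dots> = refl_class (T b) (t b) (G b (actS u x))"
      using nat' GT x(1) by (subst refl_class_eq_iff[OF reflp[OF ab(2)] transp[OF ab(2)]]) auto
    finally have "\<eta> b (reindex ?P u c) = refl_class (S b) (r b) (actS u x)"
      using \<eta>[OF ab(2)] GT x by simp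
    also have "\<dots> = refl_map (S b) (r b) (actS u) (refl_class (S a) (r a) x)"
      using rS tS ab GT mono x by (intro refl_map_refl_class[symmetric]) auto
    finally show ?thesis
      using \<eta>[OF ab(1) x(1)] x by (simp add: a_def b_def)
  qed
  have iso: "doctrine_iso C ?P ?Q \<eta>"
    using bij order natural by (simp add: doctrine_iso_def)
  moreover have "is_doctrine C ?Q"
    by (rule is_doctrine_transport[OF is_doctrine_reflected[OF prod] iso])
      (simp add: partial_order_poset_reflection rS tS)
  ultimately show ?thesis
    using is_doctrine_reflected[OF prod] unfolding isomorphic_doctrines_def by blast
qed

section \<open>Sets and pullbacks\<close>

text \<open>A binary product is a pullback over the terminal object: any two parallel arrows into it
  agree, so the commutativity condition on a test cone always holds.\<close>

lemma (in category) has_finite_products_if_pullbacks: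
  assumes t: "is_terminal C t" and pb: "has_pullbacks C"
  shows "has_finite_products C"
  unfolding has_finite_products_def
proof (intro conjI ballI)
  fix a b assume ab: "a \<in> obj C" "b \<in> obj C"
  obtain u v where u: "u \<in> arr C" "src C u = a" "tgt C u = t"
    and v: "v \<in> arr C" "src C v = b" "tgt C v = t"
    using t ab unfolding is_terminal_def hom_def by blast
  then obtain p q where pq: "is_pullback C u v p q"
    using pb unfolding has_pullbacks_def by metis
  have eq: "cmp C u f = cmp C v g" if "d \<in> obj C" "f \<in> hom C d a" "g \<in> hom C d b" for d f g
  proof -
    have "cmp C u f \<in> hom C d t" "cmp C v g \<in> hom C d t"
      using that u v cmp_arr by (auto simp: hom_def)
    then show ?thesis
      using t \<open>d \<in> obj C\<close> unfolding is_terminal_def by blast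
  qed
  have "is_product C a b p q"
    unfolding is_product_def
  proof (intro conjI ballI)
    fix d f g assume "d \<in> obj C" "f \<in> hom C d a" "g \<in> hom C d b"
    then show "\<exists>!h. h \<in> hom C d (src C p) \<and> cmp C p h = f \<and> cmp C q h = g"
      using pq u v eq unfolding is_pullback_def by blast
  qed (use pq u v in \<open>simp_all add: is_pullback_def\<close>)
  then show "\<exists>p q. is_product C a b p q" by blast
qed (use t in blast)

lemma is_pullback_pullback:
  assumes "has_pullbacks C" "u \<in> arr C" "g \<in> arr C" "tgt C u = tgt C g"
  shows "is_pullback C u g (fst (pullback C u g)) (snd (pullback C u g))"
proof -
  have "\<exists>pq. is_pullback C u g (fst pq) (snd pq)"
    using assms unfolding has_pullbacks_def by fastforce
  then show ?thesis
    unfolding pullback_def by (rule someI_ex)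
qed

section \<open>The category of sets and the points of its pullbacks\<close>

lemma set_cat_simps [simp]:
  "obj (set_cat U) = U"
  "(X, f, Y) \<in> arr (set_cat U) \<longleftrightarrow> X \<in> U \<and> Y \<in> U \<and> f \<in> X \<rightarrow>\<^sub>E Y"
  "src (set_cat U) (X, f, Y) = X"
  "tgt (set_cat U) (X, f, Y) = Y"
  "ident (set_cat U) X = (X, (\<lambda>x\<in>X. x), X)"
  "cmp (set_cat U) (Y, g, Z) (X, f, Y') = (X, compose X g f, Z)"
  by (simp_all add: set_cat_def)

lemma category_set_cat: "category (set_cat U)"
proof
  fix f g h assume "f \<in> arr (set_cat U)" "g \<in> arr (set_cat U)" "h \<in> arr (set_cat U)"
    "tgt (set_cat U) f = src (set_cat U) g" "tgt (set_cat U) g = src (set_cat U) h"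
  then show "cmp (set_cat U) (cmp (set_cat U) h g) f = cmp (set_cat U) h (cmp (set_cat U) g f)"
    by (cases f; cases g; cases h) (auto simp: compose_def fun_eq_iff)
qed (auto simp: set_cat_def compose_def fun_eq_iff PiE_def extensional_def)

lemma has_finite_products_set_cat:
  assumes "set_universe U"
  shows "has_finite_products (set_cat U)"
proof -
  interpret category "set_cat U"
    by (rule category_set_cat)
  obtain x where x: "{x} \<in> U"
    using set_universe.singleton[OF assms] by blast
  have "is_terminal (set_cat U) {x}"
    unfolding is_terminal_def
  proof (intro conjI ballI)
    fix X assume X: "X \<in> obj (set_cat U)"
    show "\<exists>!f. f \<in> hom (set_cat U) X {x}"
    proof (rule ex1I)
      show "(X, (\<lambda>_\<in>X. x), {x}) \<in> hom (set_cat U) X {x}"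
        using X x by (simp add: hom_def)
    next
      fix f assume "f \<in> hom (set_cat U) X {x}"
      then show "f = (X, (\<lambda>_\<in>X. x), {x})"
        by (cases f) (auto simp: hom_def fun_eq_iff PiE_def extensional_def)
    qed
  qed (simp add: x)
  then show ?thesis
    using has_finite_products_if_pullbacks has_pullbacks_set_cat[OF assms] by blast
qed

text \<open>Elements are maps out of a one-element set, so the universal property tested on
  \<open>{y}\<close>, which is small as a subset of \<open>Y\<close>, yields a point of
  \<open>D\<close>. The argument applies to whichever pullback has been chosen and needs no explicit
  description of \<open>D\<close>.\<close>

lemma set_pullback_point:
  assumes U: "set_universe U"
    and pb: "is_pullback (set_cat U) (Y, u, X) (B, f, X) (D, p, Y) (D, q, B)"
    and y: "y \<in> Y" and b: "b \<in> B" and eq: "u y = f b"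
  shows "\<exists>d\<in>D. p d = y \<and> q d = b"
proof -
  have YU: "Y \<in> U" "B \<in> U"
    using pb by (auto simp: is_pullback_def)
  have yU: "{y} \<in> U"
    using set_universe.subset[OF U YU(1), of "{y}"] y by simp
  define p' q' where "p' = ({y}, (\<lambda>_\<in>{y}. y), Y)" and "q' = ({y}, (\<lambda>_\<in>{y}. b), B)"
  have "p' \<in> hom (set_cat U) {y} Y" "q' \<in> hom (set_cat U) {y} B"
    using yU YU y b by (auto simp: p'_def q'_def hom_def)
  moreover have "cmp (set_cat U) (Y, u, X) p' = cmp (set_cat U) (B, f, X) q'"
    using eq by (simp add: p'_def q'_def compose_def fun_eq_iff)
  moreover have "\<forall>d\<in>U. \<forall>p'\<in>hom (set_cat U) d Y. \<forall>q'\<in>hom (set_cat U) d B.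
      cmp (set_cat U) (Y, u, X) p' = cmp (set_cat U) (B, f, X) q' \<longrightarrow>
      (\<exists>!h. h \<in> hom (set_cat U) d D \<and> cmp (set_cat U) (D, p, Y) h = p' \<and>
        cmp (set_cat U) (D, q, B) h = q')"
    using pb unfolding is_pullback_def set_cat_simps by blast
  ultimately obtain h where h: "h \<in> hom (set_cat U) {y} D"
    "cmp (set_cat U) (D, p, Y) h = p'" "cmp (set_cat U) (D, q, B) h = q'"
    using yU by blast
  then obtain k where k: "h = ({y}, k, D)" "k \<in> {y} \<rightarrow>\<^sub>E D"
    by (cases h) (auto simp: hom_def)
  have "compose {y} p k = (\<lambda>_\<in>{y}. y)" "compose {y} q k = (\<lambda>_\<in>{y}. b)"
    using h k by (simp_all add: p'_def q'_def)
  then have "p (k y) = y" "q (k y) = b"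
    by (metis compose_eq restrict_apply' singletonI)+
  then show ?thesis
    using k by auto
qed


section \<open>Muchnik reducibility\<close>

text \<open>Kleene equality is directed, but its right-hand side \<open>Some a\<close> is defined,
  so the law for \<open>k\<close> gives a genuine equality.\<close>

lemma ks_laws_K:
  assumes "ks_laws A app k s" "a \<in> A"
  shows "\<exists>ka. app k a = Some ka \<and> (\<forall>b\<in>A. app ka b = Some a)"
proof -
  obtain ka where ka: "app k a = Some ka"
    using assms unfolding ks_laws_def by blast
  have "app ka b = Some a" if "b \<in> A" for b
  proof -
    have "kleene (lapp app (app k a) (Some b)) (Some a)"
      using assms that unfolding ks_laws_def by blast
    then show ?thesis
      by (simp add: ka kleene_def lapp_def)
  qed
  then show ?thesis
    using ka by blast
qed

text \<open>The identity combinator is \<open>s k (k k)\<close>: applied to \<open>b\<close> it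
  gives \<open>k b (k k b) = k b k = b\<close>. The right-hand side of the law for \<open>s\<close>
  is defined here, so the directed law determines the value.\<close>

lemma elementary_sub_pca_identity:
  assumes "elementary_sub_pca A app A'"
  shows "\<exists>i\<in>A'. \<forall>b\<in>A. app i b = Some b"
proof -
  obtain k s where ks: "k \<in> A'" "s \<in> A'" "ks_laws A app k s" and sub: "A' \<subseteq> A"
    and closed: "\<And>a b c. a \<in> A' \<Longrightarrow> b \<in> A' \<Longrightarrow> app a b = Some c \<Longrightarrow> c \<in> A'"
    using assms unfolding elementary_sub_pca_def by blast
  note k = ks_laws_K[OF ks(3)]
  obtain kk where kk: "app k k = Some kk" "\<forall>b\<in>A. app kk b = Some k"
    using k ks sub by blast
  have kkA: "kk \<in> A'"
    using closed ks kk by blast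
  obtain sk where sk: "app s k = Some sk"
    using ks sub by (fastforce simp: ks_laws_def)
  have "lapp app (app s k) (Some kk) \<noteq> None"
    using ks sub kkA unfolding ks_laws_def by blast
  then obtain i where i: "app sk kk = Some i"
    by (auto simp: sk lapp_def)
  have "app i b = Some b" if b: "b \<in> A" for b
  proof -
    obtain kb where kb: "app k b = Some kb" "\<forall>c\<in>A. app kb c = Some b"
      using k[OF b] by blast
    have "kleene (lapp app (lapp app (app s k) (Some kk)) (Some b))
        (lapp app (app k b) (app kk b))"
      using ks sub b kkA unfolding ks_laws_def by blast
    then show ?thesis
      using kb sk i kk b ks sub by (auto simp: kleene_def lapp_def)
  qed
  moreover have "i \<in> A'"
    using closed sk i ks kkA by blast
  ultimately show ?thesis by blast
qed

text \<open>The composite is \<open>s (k a) b\<close>, since \<open>s (k a) b x\<close> equals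
  \<open>k a x (b x) = a (b x)\<close> when the latter is defined. It lies in \<open>A'\<close> by
  closure, yet acts on all of \<open>A\<close> because the laws of \<open>k\<close> and
  \<open>s\<close> hold there.\<close>

lemma elementary_sub_pca_compose:
  assumes "elementary_sub_pca A app A'" and a: "a \<in> A'" and b: "b \<in> A'"
  shows "\<exists>c\<in>A'. \<forall>x\<in>A. \<forall>y z. app b x = Some y \<longrightarrow> app a y = Some z \<longrightarrow> app c x = Some z"
proof -
  obtain k s where ks: "k \<in> A'" "s \<in> A'" "ks_laws A app k s" and sub: "A' \<subseteq> A"
    and closed: "\<And>a b c. a \<in> A' \<Longrightarrow> b \<in> A' \<Longrightarrow> app a b = Some c \<Longrightarrow> c \<in> A'"
    using assms unfolding elementary_sub_pca_def by blast
  obtain ka where ka: "app k a = Some ka" "\<forall>x\<in>A. app ka x = Some a"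
    using ks_laws_K[OF ks(3)] sub a by blast
  have kaA: "ka \<in> A'"
    using closed ks a ka by blast
  obtain sa where sa: "app s ka = Some sa"
    using ks sub kaA by (fastforce simp: ks_laws_def)
  have "lapp app (app s ka) (Some b) \<noteq> None"
    using ks sub kaA b unfolding ks_laws_def by blast
  then obtain c where c: "app sa b = Some c"
    by (auto simp: sa lapp_def)
  have "app c x = Some z" if "x \<in> A" "app b x = Some y" "app a y = Some z" for x y z
  proof -
    have "kleene (lapp app (lapp app (app s ka) (Some b)) (Some x))
        (lapp app (app ka x) (app b x))"
      using ks sub b kaA that unfolding ks_laws_def by blast
    then show ?thesis
      using that ka sa c by (simp add: kleene_def lapp_def)
  qed
  moreover have "c \<in> A'"
    using closed sa c ks kaA b by blast
  ultimately show ?thesis by blast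
qed

section \<open>The two Muchnik relations are preorders\<close>

lemma preorder_dw_le:
  assumes "elementary_sub_pca A app A'"
  shows "reflp_on (X \<rightarrow>\<^sub>E A) (dw_le app A' X)" "transp_on (X \<rightarrow>\<^sub>E A) (dw_le app A' X)"
proof -
  obtain i where "i \<in> A'" "\<forall>b\<in>A. app i b = Some b"
    using elementary_sub_pca_identity[OF assms] by blast
  then show "reflp_on (X \<rightarrow>\<^sub>E A) (dw_le app A' X)"
    by (auto intro!: reflp_onI bexI[of _ i] simp: dw_le_def PiE_iff)
  show "transp_on (X \<rightarrow>\<^sub>E A) (dw_le app A' X)"
  proof (rule transp_onI, unfold dw_le_def, intro ballI)
    fix \<alpha> \<beta> \<gamma> x
    assume \<gamma>: "\<gamma> \<in> X \<rightarrow>\<^sub>E A" and x: "x \<in> X"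
      and le: "\<forall>x\<in>X. \<exists>a\<in>A'. app a (\<beta> x) = Some (\<alpha> x)" "\<forall>x\<in>X. \<exists>a\<in>A'. app a (\<gamma> x) = Some (\<beta> x)"
    \<comment> \<open>The reducers may vary with \<open>x\<close>, so they are composed one point at
      a time.\<close>
    obtain a b where "a \<in> A'" "b \<in> A'" "app a (\<beta> x) = Some (\<alpha> x)" "app b (\<gamma> x) = Some (\<beta> x)"
      using le x by blast
    moreover have "\<gamma> x \<in> A"
      using \<gamma> x by auto
    ultimately show "\<exists>a\<in>A'. app a (\<gamma> x) = Some (\<alpha> x)"
      using elementary_sub_pca_compose[OF assms, of a b] by blast
  qed
qed

lemma preorder_w_le:
  assumes "elementary_sub_pca A app A'"
  shows "reflp_on (X \<rightarrow>\<^sub>E Pow A) (w_le app A' X)" "transp_on (X \<rightarrow>\<^sub>E Pow A) (w_le app A' X)"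
proof -
  obtain i where i: "i \<in> A'" "\<forall>b\<in>A. app i b = Some b"
    using elementary_sub_pca_identity[OF assms] by blast
  show "reflp_on (X \<rightarrow>\<^sub>E Pow A) (w_le app A' X)"
  proof (rule reflp_onI, unfold w_le_def, intro ballI)
    fix \<phi> x b assume "\<phi> \<in> X \<rightarrow>\<^sub>E Pow A" "x \<in> X" "b \<in> \<phi> x"
    then have "app i b = Some b" "b \<in> \<phi> x"
      using i by (auto simp: PiE_iff)
    then show "\<exists>a\<in>A'. \<exists>c. app a b = Some c \<and> c \<in> \<phi> x"
      using i by blast
  qed
  show "transp_on (X \<rightarrow>\<^sub>E Pow A) (w_le app A' X)"
  proof (rule transp_onI, unfold w_le_def, intro ballI)
    fix \<phi> \<psi> \<chi> x d
    assume \<chi>: "\<chi> \<in> X \<rightarrow>\<^sub>E Pow A" and x: "x \<in> X" and d: "d \<in> \<chi> x"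
      and le: "\<forall>x\<in>X. \<forall>b\<in>\<psi> x. \<exists>a\<in>A'. \<exists>c. app a b = Some c \<and> c \<in> \<phi> x"
        "\<forall>x\<in>X. \<forall>b\<in>\<chi> x. \<exists>a\<in>A'. \<exists>c. app a b = Some c \<and> c \<in> \<psi> x"
    \<comment> \<open>The element \<open>d\<close> is followed first to \<open>y\<close>, and the
      second reducer is then chosen for that \<open>y\<close>. It may depend on \<open>d\<close>,
      because reducers are chosen separately for each element.\<close>
    obtain b y where b: "b \<in> A'" "app b d = Some y" "y \<in> \<psi> x"
      using le(2) x d by blast
    then obtain a z where "a \<in> A'" "app a y = Some z" "z \<in> \<phi> x"
      using le(1) x by blast
    moreover have "d \<in> A"
      using \<chi> x d by (auto simp: PiE_iff)
    ultimately show "\<exists>a\<in>A'. \<exists>c. app a d = Some c \<and> c \<in> \<phi> x"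
      using b elementary_sub_pca_compose[OF assms, of a b] by blast
  qed
qed

text \<open>Families are extensional and \<open>compose Y\<close> restricts to \<open>Y\<close>, so
  precomposition satisfies the identity and composition laws as equations of functions.\<close>

lemma indexed_preorder_muchnik:
  assumes "elementary_sub_pca A app A'"
  shows "indexed_preorder (set_cat U) (\<lambda>X. X \<rightarrow>\<^sub>E Pow A) (w_le app A')
    (\<lambda>(Y, u, X) \<phi>. compose Y \<phi> u)"
proof -
  interpret category "set_cat U"
    by (rule category_set_cat)
  show ?thesis
  proof
    fix u :: "'b set_arr" and \<phi> \<psi> :: "'b \<Rightarrow> 'a set" assume "u \<in> arr (set_cat U)"
      "w_le app A' (tgt (set_cat U) u) \<phi> \<psi>"
    then show "w_le app A' (src (set_cat U) u) ((case u of (Y, u, X) \<Rightarrow> \<lambda>\<phi>. compose Y \<phi> u) \<phi>)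
      ((case u of (Y, u, X) \<Rightarrow> \<lambda>\<phi>. compose Y \<phi> u) \<psi>)"
      by (cases u) (auto simp: w_le_def compose_def PiE_iff)
  next
    fix f g :: "'b set_arr" and \<phi> :: "'b \<Rightarrow> 'a set"
    assume "f \<in> arr (set_cat U)" "g \<in> arr (set_cat U)" "tgt (set_cat U) f = src (set_cat U) g"
    then show "(case cmp (set_cat U) g f of (Y, u, X) \<Rightarrow> \<lambda>\<phi>. compose Y \<phi> u) \<phi>
      = (case f of (Y, u, X) \<Rightarrow> \<lambda>\<phi>. compose Y \<phi> u) ((case g of (Y, u, X) \<Rightarrow> \<lambda>\<phi>. compose Y \<phi> u) \<phi>)"
      by (cases f; cases g) (auto simp: compose_def fun_eq_iff)
  next
    fix u :: "'b set_arr" assume "u \<in> arr (set_cat U)"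
    then show "(case u of (Y, u, X) \<Rightarrow> \<lambda>\<phi>. compose Y \<phi> u)
      \<in> (tgt (set_cat U) u \<rightarrow>\<^sub>E Pow A) \<rightarrow> (src (set_cat U) u \<rightarrow>\<^sub>E Pow A)"
      by (cases u) (auto simp: compose_def PiE_iff)
  next
    fix X :: "'b set" and \<phi> :: "'b \<Rightarrow> 'a set" assume "\<phi> \<in> X \<rightarrow>\<^sub>E Pow A"
    then show "(case ident (set_cat U) X of (Y, u, X) \<Rightarrow> \<lambda>\<phi>. compose Y \<phi> u) \<phi> = \<phi>"
      by (auto simp: compose_def fun_eq_iff PiE_def extensional_def)
  qed (simp_all add: preorder_w_le[OF assms])
qed

section \<open>The doctrine of singletons computed on representatives\<close>

lemma fib_muchnik_singletons:
  "fib (muchnik_singletons A app A') X = poset_reflection (X \<rightarrow>\<^sub>E A) (dw_le app A' X)"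
  by (simp add: muchnik_singletons_def)

lemma reindex_muchnik_singletons:
  assumes "elementary_sub_pca A app A'" "u \<in> Y \<rightarrow>\<^sub>E X" "\<alpha> \<in> X \<rightarrow>\<^sub>E A"
  shows "reindex (muchnik_singletons A app A') (Y, u, X) (refl_class (X \<rightarrow>\<^sub>E A) (dw_le app A' X) \<alpha>)
    = refl_class (Y \<rightarrow>\<^sub>E A) (dw_le app A' Y) (compose Y \<alpha> u)"
  unfolding muchnik_singletons_def doctrine.simps prod.case
  using assms by (intro refl_map_refl_class preorder_dw_le)
    (auto simp: dw_le_def compose_def PiE_iff)


section \<open>The comparison map\<close>

text \<open>The second component of a pair is a class, so \<open>SOME\<close> picks a
  representative. Another choice may change the family, but only within its equivalence class for
  \<open>w_le\<close>. Points of \<open>X\<close> outside the image of \<open>f\<close> receive the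
  empty set.\<close>

definition fibre_values :: "'u set_arr \<times> ('u \<Rightarrow> 'a) set \<Rightarrow> 'u \<Rightarrow> 'a set" where
  "fibre_values = (\<lambda>((B, f, X), d). \<lambda>x\<in>X. (SOME \<alpha>. \<alpha> \<in> d) ` {b \<in> B. f b = x})"

text \<open>The representative \<alpha> is the very one that \<open>fibre_values\<close> picks, so
  arguments about a given pair can work with an honest function instead of a class.\<close>

lemma fuc_pairs_muchnik_singletonsE:
  assumes "elementary_sub_pca A app A'"
    and "x \<in> fuc_pairs (set_cat U) (muchnik_singletons A app A') X"
  obtains B f \<alpha> where "B \<in> U" "X \<in> U" "f \<in> B \<rightarrow>\<^sub>E X" "\<alpha> \<in> B \<rightarrow>\<^sub>E A"
    "x = ((B, f, X), refl_class (B \<rightarrow>\<^sub>E A) (dw_le app A' B) \<alpha>)"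
    "fibre_values x = (\<lambda>x\<in>X. \<alpha> ` {b \<in> B. f b = x})"
proof -
  obtain B f \<alpha>0 where B: "B \<in> U" "X \<in> U" "f \<in> B \<rightarrow>\<^sub>E X" "\<alpha>0 \<in> B \<rightarrow>\<^sub>E A"
    and x: "x = ((B, f, X), refl_class (B \<rightarrow>\<^sub>E A) (dw_le app A' B) \<alpha>0)"
    using assms(2) by (auto simp: fuc_pairs_def fib_muchnik_singletons carrier_poset_reflection)
  define \<alpha> where "\<alpha> = (SOME \<alpha>. \<alpha> \<in> refl_class (B \<rightarrow>\<^sub>E A) (dw_le app A' B) \<alpha>0)"
  have "\<alpha> \<in> refl_class (B \<rightarrow>\<^sub>E A) (dw_le app A' B) \<alpha>0"
    unfolding \<alpha>_def using mem_refl_class[OF preorder_dw_le(1)[OF assms(1)] B(4)] some_in_eq by blast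
  then have \<alpha>: "\<alpha> \<in> B \<rightarrow>\<^sub>E A" "dw_le app A' B \<alpha>0 \<alpha>" "dw_le app A' B \<alpha> \<alpha>0"
    by (simp_all add: refl_class_def)
  then have "refl_class (B \<rightarrow>\<^sub>E A) (dw_le app A' B) \<alpha>0 = refl_class (B \<rightarrow>\<^sub>E A) (dw_le app A' B) \<alpha>"
    using B by (simp add: refl_class_eq_iff[OF preorder_dw_le[OF assms(1)]])
  then show thesis
    using that[of B f \<alpha>] B x \<alpha>(1) by (simp add: fibre_values_def \<alpha>_def)
qed

text \<open>Both relations amount to one pointwise condition: over each \<open>g c\<close> there is
  a \<open>b\<close> in \<open>B\<close> such that some element of \<open>A'\<close> takes
  \<open>\<beta> c\<close> to \<open>\<alpha> b\<close>. The completion collects these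
  \<open>b\<close> into an arrow \<open>h\<close>, while \<open>w_le\<close> sorts them by their
  image in \<open>X\<close>.\<close>

lemma fuc_le_muchnik_singletons_iff:
  assumes E: "elementary_sub_pca A app A'"
    and x: "x \<in> fuc_pairs (set_cat U) (muchnik_singletons A app A') X"
    and y: "y \<in> fuc_pairs (set_cat U) (muchnik_singletons A app A') X"
  shows "fuc_le (set_cat U) (muchnik_singletons A app A') x y \<longleftrightarrow>
    w_le app A' X (fibre_values x) (fibre_values y)"
proof -
  obtain B f \<alpha> where B: "B \<in> U" "X \<in> U" "f \<in> B \<rightarrow>\<^sub>E X" "\<alpha> \<in> B \<rightarrow>\<^sub>E A"
    and x: "x = ((B, f, X), refl_class (B \<rightarrow>\<^sub>E A) (dw_le app A' B) \<alpha>)"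
      "fibre_values x = (\<lambda>x\<in>X. \<alpha> ` {b \<in> B. f b = x})"
    by (rule fuc_pairs_muchnik_singletonsE[OF E x])
  obtain C g \<beta> where C: "C \<in> U" "X \<in> U" "g \<in> C \<rightarrow>\<^sub>E X" "\<beta> \<in> C \<rightarrow>\<^sub>E A"
    and y: "y = ((C, g, X), refl_class (C \<rightarrow>\<^sub>E A) (dw_le app A' C) \<beta>)"
      "fibre_values y = (\<lambda>x\<in>X. \<beta> ` {c \<in> C. g c = x})"
    by (rule fuc_pairs_muchnik_singletonsE[OF E y])
  have "fuc_le (set_cat U) (muchnik_singletons A app A') x y \<longleftrightarrow>
      (\<exists>h\<in>C \<rightarrow>\<^sub>E B. compose C f h = g \<and> dw_le app A' C (compose C \<alpha> h) \<beta>)"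
  proof -
    have *: "reindex (muchnik_singletons A app A') (C, h, B)
          (refl_class (B \<rightarrow>\<^sub>E A) (dw_le app A' B) \<alpha>)
        \<sqsubseteq>\<^bsub>fib (muchnik_singletons A app A') C\<^esub> refl_class (C \<rightarrow>\<^sub>E A) (dw_le app A' C) \<beta>
      \<longleftrightarrow> dw_le app A' C (compose C \<alpha> h) \<beta>" if "h \<in> C \<rightarrow>\<^sub>E B" for h
    proof -
      have "compose C \<alpha> h \<in> C \<rightarrow>\<^sub>E A"
        using that B by (auto simp: compose_def PiE_iff)
      then show ?thesis
        using that B C by (simp add: reindex_muchnik_singletons[OF E] fib_muchnik_singletons
            le_poset_reflection_iff preorder_dw_le[OF E])
    qed
    have hom: "hom (set_cat U) C B = (\<lambda>h. (C, h, B)) ` (C \<rightarrow>\<^sub>E B)"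
      using B C by (auto simp: hom_def)
    show ?thesis
      by (simp add: fuc_le_def x y hom *)
  qed
  also have "\<dots> \<longleftrightarrow> (\<forall>c\<in>C. \<exists>b\<in>B. f b = g c \<and> (\<exists>a\<in>A'. app a (\<beta> c) = Some (\<alpha> b)))"
  proof
    assume "\<exists>h\<in>C \<rightarrow>\<^sub>E B. compose C f h = g \<and> dw_le app A' C (compose C \<alpha> h) \<beta>"
    then obtain h where "h \<in> C \<rightarrow>\<^sub>E B" "compose C f h = g" "dw_le app A' C (compose C \<alpha> h) \<beta>"
      by blast
    then show "\<forall>c\<in>C. \<exists>b\<in>B. f b = g c \<and> (\<exists>a\<in>A'. app a (\<beta> c) = Some (\<alpha> b))"
      by (auto simp: dw_le_def compose_def intro!: bexI[of _ "h _"])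
  next
    assume "\<forall>c\<in>C. \<exists>b\<in>B. f b = g c \<and> (\<exists>a\<in>A'. app a (\<beta> c) = Some (\<alpha> b))"
    \<comment> \<open>Choice assembles the witnesses \<open>b\<close> into a function. Only
      \<open>b\<close> is chosen, since the reducer may depend on \<open>c\<close>. Restricting to
      \<open>C\<close> makes the function extensional, hence an arrow.\<close>
    then obtain h where h: "\<forall>c\<in>C. h c \<in> B \<and> f (h c) = g c \<and> (\<exists>a\<in>A'. app a (\<beta> c) = Some (\<alpha> (h c)))"
      by metis
    then have "compose C f (restrict h C) = g"
      using C by (auto simp: compose_def fun_eq_iff PiE_def extensional_def)
    moreover have "restrict h C \<in> C \<rightarrow>\<^sub>E B" "dw_le app A' C (compose C \<alpha> (restrict h C)) \<beta>"
      using h by (auto simp: dw_le_def compose_def)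
    ultimately show "\<exists>h\<in>C \<rightarrow>\<^sub>E B. compose C f h = g \<and> dw_le app A' C (compose C \<alpha> h) \<beta>"
      by blast
  qed
  also have "\<dots> \<longleftrightarrow> w_le app A' X (fibre_values x) (fibre_values y)"
  proof
    assume l: "\<forall>c\<in>C. \<exists>b\<in>B. f b = g c \<and> (\<exists>a\<in>A'. app a (\<beta> c) = Some (\<alpha> b))"
    show "w_le app A' X (fibre_values x) (fibre_values y)"
      unfolding w_le_def
    proof (intro ballI)
      fix z e assume "z \<in> X" and "e \<in> fibre_values y z"
      moreover from this obtain c where "c \<in> C" "g c = z" "e = \<beta> c"
        by (auto simp: y(2))
      ultimately show "\<exists>a\<in>A'. \<exists>v. app a e = Some v \<and> v \<in> fibre_values x z"
        using l by (fastforce simp: x(2))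
    qed
  next
    assume r: "w_le app A' X (fibre_values x) (fibre_values y)"
    show "\<forall>c\<in>C. \<exists>b\<in>B. f b = g c \<and> (\<exists>a\<in>A'. app a (\<beta> c) = Some (\<alpha> b))"
    proof
      fix c assume c: "c \<in> C"
      then have "g c \<in> X" "\<beta> c \<in> fibre_values y (g c)"
        using C(3) by (auto simp: y(2))
      then obtain a v where "a \<in> A'" "app a (\<beta> c) = Some v" "v \<in> fibre_values x (g c)"
        using r unfolding w_le_def by blast
      then show "\<exists>b\<in>B. f b = g c \<and> (\<exists>a\<in>A'. app a (\<beta> c) = Some (\<alpha> b))"
        using \<open>g c \<in> X\<close> by (auto simp: x(2))
    qed
  qed
  finally show ?thesis .
qed

text \<open>The pair is the first projection of the total set of \<phi>, labelled by the second
  coordinate. Smallness of \<open>A\<close> gives this subset of \<open>X \<times> A\<close> a small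
  copy.\<close>

lemma fibre_values_surj:
  assumes U: "set_universe U" and A: "A \<in> U" and X: "X \<in> U" and \<phi>: "\<phi> \<in> X \<rightarrow>\<^sub>E Pow A"
    and E: "elementary_sub_pca A app A'"
  shows "\<exists>x\<in>fuc_pairs (set_cat U) (muchnik_singletons A app A') X.
    w_le app A' X (fibre_values x) \<phi> \<and> w_le app A' X \<phi> (fibre_values x)"
proof -
  obtain Z b where Z: "Z \<in> U" and b: "bij_betw b (X \<times> A) Z"
    using set_universe.product[OF U X A] by blast
  define W where "W = {(x, a). x \<in> X \<and> a \<in> \<phi> x}"
  have W: "W \<subseteq> X \<times> A"
    using \<phi> by (auto simp: W_def PiE_iff)
  have inj: "inj_on b W"
    using b W inj_on_subset by (auto simp: bij_betw_def)
  \<comment> \<open>The universe has products only up to bijection, so the total set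
    \<open>W\<close> is moved along \<open>b\<close> into \<open>Z\<close>. The functions
    \<open>f\<close> and \<alpha> are then its two projections.\<close>
  define B where "B = b ` W"
  have "B \<subseteq> Z"
    using b W by (auto simp: B_def bij_betw_def)
  then have BU: "B \<in> U"
    using set_universe.subset[OF U Z] by blast
  define f \<alpha> where "f = (\<lambda>z\<in>B. fst (inv_into W b z))" and "\<alpha> = (\<lambda>z\<in>B. snd (inv_into W b z))"
  have f: "f (b w) = fst w" and \<alpha>: "\<alpha> (b w) = snd w" if "w \<in> W" for w
    using that inj by (simp_all add: f_def \<alpha>_def B_def)
  have fE: "f \<in> B \<rightarrow>\<^sub>E X" and \<alpha>E: "\<alpha> \<in> B \<rightarrow>\<^sub>E A"
    using f \<alpha> W by (fastforce simp: B_def PiE_iff f_def \<alpha>_def)+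
  \<comment> \<open>An empty \<open>\<phi> x\<close> is included: then no point of \<open>B\<close>
    lies over \<open>x\<close>, as \<open>f\<close> need not be surjective.\<close>
  have img: "\<alpha> ` {z \<in> B. f z = x} = \<phi> x" if "x \<in> X" for x
  proof -
    have "\<alpha> ` {z \<in> B. f z = x} = snd ` {w \<in> W. fst w = x}"
      using f \<alpha> by (force simp: B_def)
    also have "\<dots> = \<phi> x"
      using that by (force simp: W_def)
    finally show ?thesis .
  qed
  define d where "d = refl_class (B \<rightarrow>\<^sub>E A) (dw_le app A' B) \<alpha>"
  \<comment> \<open>The representative picked by \<open>fibre_values\<close> may differ from
    \<alpha>. As the two are equivalent, \<phi> is recovered up to equivalence by reducing at each
    \<open>z\<close> separately.\<close>
  define \<beta> where "\<beta> = (SOME \<beta>. \<beta> \<in> d)"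
  have pair: "((B, f, X), d) \<in> fuc_pairs (set_cat U) (muchnik_singletons A app A') X"
    using BU X fE \<alpha>E
    by (simp add: fuc_pairs_def fib_muchnik_singletons carrier_poset_reflection d_def)
  have "\<beta> \<in> d"
    unfolding \<beta>_def d_def using mem_refl_class[OF preorder_dw_le(1)[OF E] \<alpha>E] some_in_eq by blast
  then have le: "dw_le app A' B \<alpha> \<beta>" "dw_le app A' B \<beta> \<alpha>"
    by (simp_all add: d_def refl_class_def)
  have val: "fibre_values ((B, f, X), d) x = \<beta> ` {z \<in> B. f z = x}" if "x \<in> X" for x
    using that by (simp add: fibre_values_def \<beta>_def)
  have "w_le app A' X (fibre_values ((B, f, X), d)) \<phi>"
    unfolding w_le_def
  proof (intro ballI)
    fix x y assume x: "x \<in> X" and "y \<in> \<phi> x"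
    then obtain z where "z \<in> B" "f z = x" "y = \<alpha> z"
      using img by blast
    then show "\<exists>a\<in>A'. \<exists>c. app a y = Some c \<and> c \<in> fibre_values ((B, f, X), d) x"
      using le(2) val[OF x] unfolding dw_le_def by blast
  qed
  moreover have "w_le app A' X \<phi> (fibre_values ((B, f, X), d))"
    unfolding w_le_def
  proof (intro ballI)
    fix x y assume x: "x \<in> X" and "y \<in> fibre_values ((B, f, X), d) x"
    then obtain z where z: "z \<in> B" "f z = x" "y = \<beta> z"
      using val by blast
    then have "\<alpha> z \<in> \<phi> x"
      using img[OF x] by blast
    then show "\<exists>a\<in>A'. \<exists>c. app a y = Some c \<and> c \<in> \<phi> x"
      using le(1) z unfolding dw_le_def by blast
  qed
  ultimately show ?thesis
    using pair by blast
qed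

text \<open>The equivalence below is not an equality, because \<^const>\<open>fibre_values\<close> chooses a
  representative of each class.\<close>

lemma fuc_act_muchnik_singletons:
  assumes U: "set_universe U" and E: "elementary_sub_pca A app A'"
    and u: "u \<in> arr (set_cat U)"
    and x: "x \<in> fuc_pairs (set_cat U) (muchnik_singletons A app A') (tgt (set_cat U) u)"
  defines "ux \<equiv> fuc_act (set_cat U) (muchnik_singletons A app A') u x"
  shows "ux \<in> fuc_pairs (set_cat U) (muchnik_singletons A app A') (src (set_cat U) u)"
    and "w_le app A' (src (set_cat U) u) (fibre_values ux)
      ((\<lambda>(Y, u, X) \<phi>. compose Y \<phi> u) u (fibre_values x))"
    and "w_le app A' (src (set_cat U) u) ((\<lambda>(Y, u, X) \<phi>. compose Y \<phi> u) u (fibre_values x))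
      (fibre_values ux)"
proof -
  obtain Y v X where uv: "u = (Y, v, X)"
    by (cases u)
  have v: "Y \<in> U" "X \<in> U" "v \<in> Y \<rightarrow>\<^sub>E X"
    using u by (simp_all add: uv)
  obtain B f \<alpha> where B: "B \<in> U" "X \<in> U" "f \<in> B \<rightarrow>\<^sub>E X" "\<alpha> \<in> B \<rightarrow>\<^sub>E A"
    and xd: "x = ((B, f, X), refl_class (B \<rightarrow>\<^sub>E A) (dw_le app A' B) \<alpha>)"
      "fibre_values x = (\<lambda>x\<in>X. \<alpha> ` {b \<in> B. f b = x})"
    by (rule fuc_pairs_muchnik_singletonsE[OF E x[unfolded uv set_cat_simps]])
  obtain P Q where PQ: "pullback (set_cat U) u (B, f, X) = (P, Q)"
    by (cases "pullback (set_cat U) u (B, f, X)")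
  have "is_pullback (set_cat U) u (B, f, X) P Q"
    using is_pullback_pullback[OF has_pullbacks_set_cat[OF U] u, of "(B, f, X)"] B v
    by (simp add: uv PQ[unfolded uv])
  moreover obtain D p Y' D' q B' where "P = (D, p, Y')" "Q = (D', q, B')"
    by (cases P; cases Q)
  ultimately have pb: "is_pullback (set_cat U) (Y, v, X) (B, f, X) (D, p, Y) (D, q, B)"
    and P: "P = (D, p, Y)" and Q: "Q = (D, q, B)"
    by (auto simp: uv is_pullback_def)
  have D: "D \<in> U" "p \<in> D \<rightarrow>\<^sub>E Y" "q \<in> D \<rightarrow>\<^sub>E B" and "compose D v p = compose D f q"
    using pb by (auto simp: is_pullback_def)
  then have sq: "v (p d) = f (q d)" if "d \<in> D" for d
    using that by (metis compose_eq)
  have \<alpha>q: "compose D \<alpha> q \<in> D \<rightarrow>\<^sub>E A"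
    using B D by (auto simp: compose_def PiE_iff)
  have act: "ux = ((D, p, Y), refl_class (D \<rightarrow>\<^sub>E A) (dw_le app A' D) (compose D \<alpha> q))"
    using B D by (simp add: ux_def fuc_act_def xd PQ P Q reindex_muchnik_singletons[OF E])
  show pair: "ux \<in> fuc_pairs (set_cat U) (muchnik_singletons A app A') (src (set_cat U) u)"
    using D v \<alpha>q
    by (simp add: act uv fuc_pairs_def fib_muchnik_singletons carrier_poset_reflection)
  obtain D' p' \<beta> where D': "D' \<in> U" "Y \<in> U" "p' \<in> D' \<rightarrow>\<^sub>E Y" "\<beta> \<in> D' \<rightarrow>\<^sub>E A"
      "ux = ((D', p', Y), refl_class (D' \<rightarrow>\<^sub>E A) (dw_le app A' D') \<beta>)"
      "fibre_values ux = (\<lambda>y\<in>Y. \<beta> ` {d \<in> D'. p' d = y})"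
    by (rule fuc_pairs_muchnik_singletonsE[OF E pair[unfolded uv set_cat_simps]])
  \<comment> \<open>The two descriptions of \<open>ux\<close> share the arrow to \<open>Y\<close>,
    whereas \<beta> is only equivalent to the composite of \<alpha> with \<open>q\<close>.\<close>
  moreover from D'(5) have "D' = D" "p' = p"
    by (simp_all add: act)
  ultimately have \<beta>: "\<beta> \<in> D \<rightarrow>\<^sub>E A"
      "refl_class (D \<rightarrow>\<^sub>E A) (dw_le app A' D) (compose D \<alpha> q)
        = refl_class (D \<rightarrow>\<^sub>E A) (dw_le app A' D) \<beta>"
      "fibre_values ux = (\<lambda>y\<in>Y. \<beta> ` {d \<in> D. p d = y})"
    using act by auto
  have le: "dw_le app A' D (compose D \<alpha> q) \<beta>" "dw_le app A' D \<beta> (compose D \<alpha> q)"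
    using \<beta>(1,2) \<alpha>q by (simp_all add: refl_class_eq_iff[OF preorder_dw_le[OF E]])
  have val: "compose Y (fibre_values x) v y = \<alpha> ` {b \<in> B. f b = v y}" if "y \<in> Y" for y
    using that v by (auto simp: compose_def xd(2))
  show "w_le app A' (src (set_cat U) u) (fibre_values ux)
      ((\<lambda>(Y, u, X) \<phi>. compose Y \<phi> u) u (fibre_values x))"
    unfolding w_le_def uv set_cat_simps prod.case
  proof (intro ballI)
    fix y e assume y: "y \<in> Y" and "e \<in> compose Y (fibre_values x) v y"
    then obtain b where b: "b \<in> B" "f b = v y" "e = \<alpha> b"
      using val by auto
    \<comment> \<open>This is where universality enters: a point \<open>b\<close> over
      \<open>v y\<close> has to lift to a point of the pullback over \<open>y\<close>.\<close>
    then obtain d where "d \<in> D" "p d = y" "q d = b"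
      using set_pullback_point[OF U pb y b(1)] by auto
    then show "\<exists>a\<in>A'. \<exists>c. app a e = Some c \<and>
        c \<in> fibre_values ux y"
      using le(2) b y unfolding \<beta>(3) dw_le_def by (fastforce simp: compose_eq)
  qed
  show "w_le app A' (src (set_cat U) u) ((\<lambda>(Y, u, X) \<phi>. compose Y \<phi> u) u (fibre_values x))
      (fibre_values ux)"
    unfolding w_le_def uv set_cat_simps prod.case
  proof (intro ballI)
    fix y e assume y: "y \<in> Y"
      and "e \<in> fibre_values ux y"
    then obtain d where d: "d \<in> D" "p d = y" "e = \<beta> d"
      unfolding \<beta>(3) by auto
    then obtain a where "a \<in> A'" "app a e = Some (\<alpha> (q d))"
      using le(1) unfolding dw_le_def by (auto simp: compose_eq)
    \<comment> \<open>The reverse comparison uses only that the pullback square commutes.\<close>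
    moreover have "q d \<in> B" "f (q d) = v y"
      using d D sq by auto
    ultimately show "\<exists>a\<in>A'. \<exists>c. app a e = Some c \<and> c \<in> compose Y (fibre_values x) v y"
      using val[OF y] by blast
  qed
qed

section \<open>The comparison map meets the criterion for isomorphic doctrines\<close>

theorem theorem4p12:
  fixes U :: "'u set set"
    and A A' :: "'u set"
    and app :: "'u \<Rightarrow> 'u \<Rightarrow> 'u option"
  assumes "set_universe U"
    and "A \<in> U"
    and "pca A app"
    and "elementary_sub_pca A app A'"
  shows "isomorphic_doctrines (set_cat U)
           (muchnik A app A')
           (full_universal_completion (set_cat U) (muchnik_singletons A app A'))"
proof -
  interpret indexed_preorder "set_cat U" "\<lambda>X. X \<rightarrow>\<^sub>E Pow A" "w_le app A'"
      "\<lambda>(Y, u, X) \<phi>. compose Y \<phi> u"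
    using assms(4) by (rule indexed_preorder_muchnik)
  \<comment> \<open>The two sides differ only in how the arrow is destructured, so the general
    criterion speaks of the Muchnik doctrine itself.\<close>
  have muchnik: "muchnik A app A' = reflected_doctrine"
    by (simp add: muchnik_def reflected_doctrine_def fun_eq_iff)
  \<comment> \<open>The role of \<open>G\<close> is played by \<open>fibre_values\<close>. It runs
    from pairs to families, while the isomorphism obtained from it by preimages runs from families
    to pairs.\<close>
  show ?thesis
    unfolding muchnik full_universal_completion_def
  proof (rule isomorphic_reflected_doctrine)
    fix X :: "'u set"
    show "fibre_values \<in> fuc_pairs (set_cat U) (muchnik_singletons A app A') X
        \<rightarrow> (X \<rightarrow>\<^sub>E Pow A)"
      by (auto elim!: fuc_pairs_muchnik_singletonsE[OF assms(4)])
  next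
    fix u x assume "u \<in> arr (set_cat U)"
      "x \<in> fuc_pairs (set_cat U) (muchnik_singletons A app A') (tgt (set_cat U) u)"
    then show "w_le app A' (src (set_cat U) u)
        (fibre_values (fuc_act (set_cat U) (muchnik_singletons A app A') u x))
        ((\<lambda>(Y, u, X) \<phi>. compose Y \<phi> u) u (fibre_values x)) \<and>
      w_le app A' (src (set_cat U) u) ((\<lambda>(Y, u, X) \<phi>. compose Y \<phi> u) u (fibre_values x))
        (fibre_values (fuc_act (set_cat U) (muchnik_singletons A app A') u x))"
      using fuc_act_muchnik_singletons(2,3)[OF assms(1,4)] by blast
  next
    show "has_finite_products (set_cat U)"
      using assms(1) by (rule has_finite_products_set_cat)
  next
    fix X x y assume "x \<in> fuc_pairs (set_cat U) (muchnik_singletons A app A') X"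
      "y \<in> fuc_pairs (set_cat U) (muchnik_singletons A app A') X"
    then show "fuc_le (set_cat U) (muchnik_singletons A app A') x y \<longleftrightarrow>
        w_le app A' X (fibre_values x) (fibre_values y)"
      by (rule fuc_le_muchnik_singletons_iff[OF assms(4)])
  next
    fix X :: "'u set" and \<phi> assume "X \<in> obj (set_cat U)" "\<phi> \<in> X \<rightarrow>\<^sub>E Pow A"
    then show "\<exists>x\<in>fuc_pairs (set_cat U) (muchnik_singletons A app A') X.
        w_le app A' X (fibre_values x) \<phi> \<and> w_le app A' X \<phi> (fibre_values x)"
      using fibre_values_surj[OF assms(1,2) _ _ assms(4)] by simp
  next
    fix u assume "u \<in> arr (set_cat U)"
    then show "fuc_act (set_cat U) (muchnik_singletons A app A') u
        \<in> fuc_pairs (set_cat U) (muchnik_singletons A app A') (tgt (set_cat U) u)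
          \<rightarrow> fuc_pairs (set_cat U) (muchnik_singletons A app A') (src (set_cat U) u)"
      using fuc_act_muchnik_singletons(1)[OF assms(1,4)] by blast
  qed
qed

end
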